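(* Let $k$ be a positive integer. A subgraph ideal $\mathcal C$ is edge $k$-scattered if and only if \[\{K_{1,1},K_{1,2},K_{1,3},\ldots\}\not\subseteq\mathcal C\] and \[\{T,2T,3T,4T,\ldots\}\not\subseteq\mathcal C\] for every tree $T$ on $k+1$ vertices.
   Context: All graphs are finite, undirected and simple. For a finite set $X$ and $f:2^X\to\mathbb Z$, the $f$-width of a partition $(X_1,\ldots,X_m)$ of $X$ is $\max\{f(\bigcup_{i\in I}X_i): I\subseteq\{1,\ldots,m\}\}$; the $k$-brittleness of $f$ is the minimum $f$-width over all partitions of $X$ into parts of size at most $k$. For a graph $G$ and $S\subseteq V(G)$, let $\eta_G(S)$ be the number of edges incident with both a vertex in $S$ and a vertex not in $S$. The edge $k$-brittleness of $G$ is the $k$-brittleness of $\eta_G:2^{V(G)}\to\mathbb Z$. A class $\mathcal C$ of graphs is edge $k$-scattered if the edge $k$-brittleness of graphs in $\mathcal C$ is bounded (by a constant depending only on $\mathcal C$). A class $\mathcal C$ of graphs is a subgraph ideal if it contains every graph isomorphic to a subgraph of a graph in $\mathcal C$. $mT$ denotes the disjoint union of $m$ copies of $T$, and $K_{1,n}$ is the star with $n$ leaves. *)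

theory Defs
  imports Main "HOL-Library.Disjoint_Sets" "HOL-Library.Infinite_Typeclass"
begin

record 'a ugraph =
  vertices :: "'a set"
  edges :: "'a set set"

definition simple_graph :: "'a ugraph \<Rightarrow> bool" where
  "simple_graph G \<longleftrightarrow>
     finite (vertices G) \<and> edges G \<subseteq> {e. e \<subseteq> vertices G \<and> card e = 2}"

definition subgraph_of :: "'a ugraph \<Rightarrow> 'a ugraph \<Rightarrow> bool" where
  "subgraph_of H G \<longleftrightarrow>
     simple_graph H \<and> vertices H \<subseteq> vertices G \<and> edges H \<subseteq> edges G"

definition graph_iso :: "'a ugraph \<Rightarrow> 'b ugraph \<Rightarrow> bool" where
  "graph_iso G H \<longleftrightarrow>
     (\<exists>f. bij_betw f (vertices G) (vertices H) \<and> (\<lambda>e. f ` e) ` edges G = edges H)"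

definition adjacency :: "'a ugraph \<Rightarrow> 'a rel" where
  "adjacency G = {(u, v). {u, v} \<in> edges G}"

definition connected_graph :: "'a ugraph \<Rightarrow> bool" where
  "connected_graph G \<longleftrightarrow>
     vertices G \<noteq> {} \<and> (\<forall>u\<in>vertices G. \<forall>v\<in>vertices G. (u, v) \<in> (adjacency G)\<^sup>*)"

definition is_cycle :: "'a ugraph \<Rightarrow> 'a list \<Rightarrow> bool" where
  "is_cycle G c \<longleftrightarrow>
     3 \<le> length c \<and> distinct c \<and>
     (\<forall>i<length c. {c ! i, c ! (Suc i mod length c)} \<in> edges G)"

definition is_tree :: "'a ugraph \<Rightarrow> bool" where
  "is_tree T \<longleftrightarrow> simple_graph T \<and> connected_graph T \<and> (\<nexists>c. is_cycle T c)"

definition star_graph :: "nat \<Rightarrow> nat ugraph" where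
  "star_graph n = \<lparr> vertices = {0..n}, edges = {{0, i} |i. 1 \<le> i \<and> i \<le> n} \<rparr>"

definition copies :: "nat \<Rightarrow> 'a ugraph \<Rightarrow> (nat \<times> 'a) ugraph" where
  "copies m T =
     \<lparr> vertices = {..<m} \<times> vertices T,
       edges = {Pair i ` e |i e. i < m \<and> e \<in> edges T} \<rparr>"

text \<open>
  A partition is the set of its parts. Admitting empty parts, or indexing the parts, would not
  change the set of unions of parts, hence not the width.
\<close>

definition f_width :: "('a set \<Rightarrow> int) \<Rightarrow> 'a set set \<Rightarrow> int" where
  "f_width f P = Max {f (\<Union>I) |I. I \<subseteq> P}"

text \<open>
  For finite \<open>X\<close> and \<open>k \<ge> 1\<close> the minimum ranges over a finite nonempty set
  (the partition into singletons qualifies).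
\<close>

definition brittleness :: "nat \<Rightarrow> 'a set \<Rightarrow> ('a set \<Rightarrow> int) \<Rightarrow> int" where
  "brittleness k X f =
     Min {f_width f P |P. partition_on X P \<and> (\<forall>A\<in>P. card A \<le> k)}"

definition cut_size :: "'a ugraph \<Rightarrow> 'a set \<Rightarrow> int" where
  "cut_size G S = int (card {e \<in> edges G. (\<exists>u\<in>e. u \<in> S) \<and> (\<exists>v\<in>e. v \<notin> S)})"

definition edge_brittleness :: "nat \<Rightarrow> 'a ugraph \<Rightarrow> int" where
  "edge_brittleness k G = brittleness k (vertices G) (cut_size G)"

definition edge_scattered :: "nat \<Rightarrow> 'a ugraph set \<Rightarrow> bool" where
  "edge_scattered k \<C> \<longleftrightarrow> (\<exists>b. \<forall>G\<in>\<C>. edge_brittleness k G \<le> b)"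

text \<open>
  A class of graphs is a set of simple graphs on vertices of one infinite type; since graphs are
  finite, every graph has an isomorphic copy on such vertices.
\<close>

definition subgraph_ideal :: "'a::infinite ugraph set \<Rightarrow> bool" where
  "subgraph_ideal \<C> \<longleftrightarrow>
     (\<forall>G\<in>\<C>. simple_graph G) \<and>
     (\<forall>G\<in>\<C>. \<forall>H K. subgraph_of H G \<and> simple_graph K \<and> graph_iso K H \<longrightarrow> K \<in> \<C>)"

text \<open>
  Membership of a graph in a class that is closed under isomorphism, for a graph whose vertices
  may be of another type.
\<close>

definition in_class :: "'b ugraph \<Rightarrow> 'a ugraph set \<Rightarrow> bool" where
  "in_class H \<C> \<longleftrightarrow> (\<exists>G\<in>\<C>. graph_iso H G)"

end

theory Submission
  imports Defs
begin

text \<open>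
  Call an edge crossing for a partition if no part contains both of its ends. The width of a
  partition for the cut function equals the number of crossing edges up to a factor of two: an edge
  cut by a union of parts is crossing, and a uniformly random union of parts cuts each crossing
  edge with probability one half. So a class is edge \<open>k\<close>-scattered iff its graphs have partitions
  into parts of size at most \<open>k\<close> with a bounded number of crossing edges
  (\<open>edge_scattered_iff_crossing\<close>).

  Large stars and many copies of a tree on \<open>k + 1\<close> vertices rule this out. In a star, the part of
  the centre contains few leaves and the edges to all others are crossing. In \<open>mT\<close>, every copy of
  \<open>T\<close> is connected and too large for a part, hence contributes a crossing edge.

  Conversely, suppose that the class omits a star, so that degrees are bounded, and that for every
  tree \<open>T\<close> on \<open>k + 1\<close> vertices it omits some \<open>mT\<close>. As such trees have finitely many isomorphism
  types, the number of pairwise disjoint subtrees on \<open>k + 1\<close> vertices in a graph \<open>G\<close> of the class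
  is bounded (\<open>tree_packing_bounded\<close>). Let \<open>X\<close> be the vertex set of a largest such packing. No
  component of \<open>G - X\<close> has more than \<open>k\<close> vertices, because it would contain another such
  tree. Partition \<open>G\<close> into these components and the singletons of \<open>X\<close>: all crossing edges are
  incident with the bounded set \<open>X\<close> of vertices of bounded degree.
\<close>

section \<open>Width and crossing edges\<close>

definition crossing_edges :: "'a ugraph \<Rightarrow> 'a set set \<Rightarrow> 'a set set" where
  "crossing_edges G P = {e \<in> edges G. \<forall>A\<in>P. \<not> e \<subseteq> A}"

definition cut_edges :: "'a ugraph \<Rightarrow> 'a set \<Rightarrow> 'a set set" where
  "cut_edges G S = {e \<in> edges G. (\<exists>u\<in>e. u \<in> S) \<and> (\<exists>v\<in>e. v \<notin> S)}"

definition small_partition :: "nat \<Rightarrow> 'a set \<Rightarrow> 'a set set \<Rightarrow> bool" where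
  "small_partition k X P \<longleftrightarrow> partition_on X P \<and> (\<forall>A\<in>P. card A \<le> k)"

lemma cut_size_eq: "cut_size G S = int (card (cut_edges G S))"
  by (simp add: cut_size_def cut_edges_def)

lemma finite_edges: "simple_graph G \<Longrightarrow> finite (edges G)"
  unfolding simple_graph_def by (rule finite_subset[of _ "Pow (vertices G)"]) auto

lemma edge_endpoints:
  assumes "simple_graph G" "e \<in> edges G"
  obtains u v where "e = {u, v}" "u \<noteq> v" "u \<in> vertices G" "v \<in> vertices G"
proof -
  from assms have "e \<subseteq> vertices G" "card e = 2" by (auto simp: simple_graph_def)
  then show ?thesis using that by (auto simp: card_2_iff)
qed

lemma finite_crossing_edges: "simple_graph G \<Longrightarrow> finite (crossing_edges G P)"
  by (simp add: crossing_edges_def finite_edges)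

lemma partition_part_unique:
  "partition_on X P \<Longrightarrow> A \<in> P \<Longrightarrow> B \<in> P \<Longrightarrow> x \<in> A \<Longrightarrow> x \<in> B \<Longrightarrow> A = B"
  by (auto simp: partition_on_def disjoint_def)

lemma finite_width_values:
  assumes "finite P"
  shows "finite {f (\<Union>I) |I. I \<subseteq> P}"
proof -
  have "{f (\<Union>I) |I. I \<subseteq> P} = (\<lambda>I. f (\<Union>I)) ` Pow P" by auto
  then show ?thesis using assms by simp
qed

lemma f_width_ge: "finite P \<Longrightarrow> I \<subseteq> P \<Longrightarrow> f (\<Union>I) \<le> f_width f P"
  unfolding f_width_def by (rule Max_ge[OF finite_width_values]) auto

lemma f_width_le:
  assumes "finite P" "\<And>I. I \<subseteq> P \<Longrightarrow> f (\<Union>I) \<le> b"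
  shows "f_width f P \<le> b"
  unfolding f_width_def
  by (rule Max.boundedI[OF finite_width_values]) (use assms in auto)

lemma f_width_le_crossing:
  assumes "simple_graph G" "partition_on (vertices G) P"
  shows "f_width (cut_size G) P \<le> int (card (crossing_edges G P))"
proof (rule f_width_le)
  show "finite P"
    using assms by (auto simp: simple_graph_def intro: finite_elements)
  fix I assume "I \<subseteq> P"
  have "cut_edges G (\<Union>I) \<subseteq> crossing_edges G P"
  proof
    fix e assume "e \<in> cut_edges G (\<Union>I)"
    then obtain u v B where e: "e \<in> edges G" "u \<in> e" "v \<in> e" "u \<in> B" "B \<in> I" "v \<notin> \<Union>I"
      by (auto simp: cut_edges_def)
    have "\<not> e \<subseteq> A" if "A \<in> P" for A
      using partition_part_unique[OF assms(2) that, of B u] e \<open>I \<subseteq> P\<close> by auto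
    then show "e \<in> crossing_edges G P" using e by (auto simp: crossing_edges_def)
  qed
  then show "cut_size G (\<Union>I) \<le> int (card (crossing_edges G P))"
    by (simp add: cut_size_eq card_mono finite_crossing_edges assms(1))
qed

text \<open>
  Half of all unions of parts cut a given crossing edge: adding or removing the part of one end
  exchanges the unions that cut it with those that do not.
\<close>

lemma half_of_unions_cut_crossing_edge:
  assumes G: "simple_graph G" and P: "partition_on (vertices G) P" and e: "e \<in> crossing_edges G P"
  shows "2 * card {I \<in> Pow P. e \<in> cut_edges G (\<Union>I)} = 2 ^ card P"
proof -
  have fP: "finite P" using G P by (auto simp: simple_graph_def intro: finite_elements)
  have eE: "e \<in> edges G" using e by (simp add: crossing_edges_def)
  obtain u v where uv: "e = {u, v}" "u \<in> vertices G" "v \<in> vertices G"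
    using edge_endpoints[OF G eE] by metis
  obtain A where A: "A \<in> P" "u \<in> A" using P uv(2) by (auto simp: partition_on_def)
  obtain B where B: "B \<in> P" "v \<in> B" using P uv(3) by (auto simp: partition_on_def)
  have "A \<noteq> B" using e uv A B by (auto simp: crossing_edges_def)
  have mem: "x \<in> \<Union>I \<longleftrightarrow> C \<in> I" if "I \<subseteq> P" "C \<in> P" "x \<in> C" for I C x
    using that partition_part_unique[OF P] by blast
  have cut: "e \<in> cut_edges G (\<Union>I) \<longleftrightarrow> (A \<in> I \<longleftrightarrow> B \<notin> I)" if "I \<subseteq> P" for I
    using mem[OF that A] mem[OF that B] eE uv(1) by (auto simp: cut_edges_def)
  define flip where "flip I = (if A \<in> I then I - {A} else insert A I)" for I
  let ?C = "{I \<in> Pow P. e \<in> cut_edges G (\<Union>I)}" and ?D = "{I \<in> Pow P. e \<notin> cut_edges G (\<Union>I)}"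
  have flip_P: "flip I \<subseteq> P" if "I \<subseteq> P" for I using that A by (auto simp: flip_def)
  have flip_flip: "flip (flip I) = I" for I by (auto simp: flip_def)
  have flip_cut: "e \<in> cut_edges G (\<Union>(flip I)) \<longleftrightarrow> e \<notin> cut_edges G (\<Union>I)" if "I \<subseteq> P" for I
    unfolding cut[OF flip_P[OF that]] cut[OF that] using \<open>A \<noteq> B\<close> by (auto simp: flip_def)
  have "bij_betw flip ?C ?D"
    by (rule bij_betw_byWitness[where f' = flip]) (use flip_P flip_flip flip_cut in auto)
  then have "card ?C = card ?D" by (rule bij_betw_same_card)
  moreover have "card (Pow P) = card ?C + card ?D"
    by (subst card_Un_disjoint[symmetric]) (use fP in \<open>auto intro!: arg_cong[of _ _ card]\<close>)
  ultimately show ?thesis using fP by (simp add: card_Pow)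
qed

lemma crossing_le_double_f_width:
  assumes G: "simple_graph G" and P: "partition_on (vertices G) P"
  shows "int (card (crossing_edges G P)) \<le> 2 * f_width (cut_size G) P"
proof -
  let ?F = "crossing_edges G P" and ?w = "f_width (cut_size G) P"
  have fP: "finite P" using G P by (auto simp: simple_graph_def intro: finite_elements)
  have fF: "finite ?F" using G by (rule finite_crossing_edges)
  have "card ?F * 2 ^ card P = (\<Sum>e\<in>?F. 2 * card {I \<in> Pow P. e \<in> cut_edges G (\<Union>I)})"
    using half_of_unions_cut_crossing_edge[OF G P] by simp
  also have "\<dots> = 2 * (\<Sum>e\<in>?F. \<Sum>I | I \<in> Pow P \<and> e \<in> cut_edges G (\<Union>I). 1)"
    by (simp add: sum_distrib_left)
  also have "\<dots> = 2 * (\<Sum>I\<in>Pow P. \<Sum>e | e \<in> ?F \<and> e \<in> cut_edges G (\<Union>I). 1)"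
    using sum.swap_restrict[of ?F "Pow P" "\<lambda>_ _. 1::nat" "\<lambda>e I. e \<in> cut_edges G (\<Union>I)"] fF fP
    by simp
  finally have "int (card ?F * 2 ^ card P) =
      2 * (\<Sum>I\<in>Pow P. int (card {e \<in> ?F. e \<in> cut_edges G (\<Union>I)}))"
    by simp
  also have "\<dots> \<le> 2 * (\<Sum>I\<in>Pow P. ?w)"
  proof (intro mult_left_mono sum_mono)
    fix I assume "I \<in> Pow P"
    have "finite (cut_edges G (\<Union>I))" using G by (simp add: cut_edges_def finite_edges)
    then have "int (card {e \<in> ?F. e \<in> cut_edges G (\<Union>I)}) \<le> cut_size G (\<Union>I)"
      unfolding cut_size_eq by (auto intro: card_mono)
    also have "\<dots> \<le> ?w" using f_width_ge[OF fP, of I] \<open>I \<in> Pow P\<close> by auto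
    finally show "int (card {e \<in> ?F. e \<in> cut_edges G (\<Union>I)}) \<le> ?w" .
  qed simp
  also have "\<dots> = (2 * ?w) * 2 ^ card P" using fP by (simp add: card_Pow)
  finally have "int (card ?F) * 2 ^ card P \<le> (2 * ?w) * 2 ^ card P" by simp
  then show ?thesis by (rule mult_right_le_imp_le) simp
qed

lemma brittleness_attained_and_minimal:
  assumes "finite X" "k > 0"
  shows "\<exists>P. small_partition k X P \<and> brittleness k X f = f_width f P"
    and "small_partition k X P \<Longrightarrow> brittleness k X f \<le> f_width f P"
proof -
  let ?W = "{f_width f P |P. partition_on X P \<and> (\<forall>A\<in>P. card A \<le> k)}"
  have "?W \<subseteq> f_width f ` Pow (Pow X)" by (auto simp: partition_on_def)
  then have fin: "finite ?W" by (rule finite_subset) (use assms in simp)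
  have "partition_on X ((\<lambda>x. {x}) ` X) \<and> (\<forall>A\<in>(\<lambda>x. {x}) ` X. card A \<le> k)"
    using assms by (auto simp: partition_on_def disjoint_def)
  then have "?W \<noteq> {}" by blast
  then have "Min ?W \<in> ?W" using fin by (rule Min_in[rotated])
  then show "\<exists>P. small_partition k X P \<and> brittleness k X f = f_width f P"
    unfolding brittleness_def small_partition_def by blast
  show "brittleness k X f \<le> f_width f P" if "small_partition k X P"
    unfolding brittleness_def using that fin by (auto simp: small_partition_def intro!: Min_le)
qed

lemma edge_scattered_iff_crossing:
  assumes "k > 0" and simple: "\<And>G. G \<in> \<C> \<Longrightarrow> simple_graph G"
  shows "edge_scattered k \<C> \<longleftrightarrow>
    (\<exists>b. \<forall>G\<in>\<C>. \<exists>P. small_partition k (vertices G) P \<and> card (crossing_edges G P) \<le> b)"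
proof
  assume "edge_scattered k \<C>"
  then obtain b where b: "\<And>G. G \<in> \<C> \<Longrightarrow> edge_brittleness k G \<le> b"
    by (auto simp: edge_scattered_def)
  have "\<exists>P. small_partition k (vertices G) P \<and> card (crossing_edges G P) \<le> nat (2 * b)"
    if "G \<in> \<C>" for G
  proof -
    have G: "simple_graph G" using that by (rule simple)
    then have "finite (vertices G)" by (simp add: simple_graph_def)
    then obtain P where P: "small_partition k (vertices G) P"
        "edge_brittleness k G = f_width (cut_size G) P"
      using brittleness_attained_and_minimal(1)[OF _ \<open>k > 0\<close>]
      unfolding edge_brittleness_def by metis
    then have "int (card (crossing_edges G P)) \<le> 2 * b"
      using crossing_le_double_f_width[OF G, of P] b[OF that] by (simp add: small_partition_def)
    then show ?thesis using P by auto
  qed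
  then show "\<exists>b. \<forall>G\<in>\<C>. \<exists>P. small_partition k (vertices G) P \<and> card (crossing_edges G P) \<le> b"
    by blast
next
  assume "\<exists>b. \<forall>G\<in>\<C>. \<exists>P. small_partition k (vertices G) P \<and> card (crossing_edges G P) \<le> b"
  then obtain b where b: "\<And>G. G \<in> \<C> \<Longrightarrow>
      \<exists>P. small_partition k (vertices G) P \<and> card (crossing_edges G P) \<le> b"
    by blast
  have "edge_brittleness k G \<le> int b" if "G \<in> \<C>" for G
  proof -
    have G: "simple_graph G" using that by (rule simple)
    obtain P where P: "small_partition k (vertices G) P" "card (crossing_edges G P) \<le> b"
      using b[OF \<open>G \<in> \<C>\<close>] by blast
    have "edge_brittleness k G \<le> f_width (cut_size G) P"
      unfolding edge_brittleness_def
      by (rule brittleness_attained_and_minimal(2))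
        (use G P \<open>k > 0\<close> in \<open>auto simp: simple_graph_def\<close>)
    also have "\<dots> \<le> int (card (crossing_edges G P))"
      using f_width_le_crossing[OF G] P by (simp add: small_partition_def)
    finally show ?thesis using P by linarith
  qed
  then show "edge_scattered k \<C>" by (auto simp: edge_scattered_def)
qed

section \<open>Graphs with many crossing edges\<close>

text \<open>
  The part of the centre contains at most \<open>k\<close> leaves, and every edge to a leaf outside that part is
  crossing.
\<close>

lemma star_crossing_edges:
  assumes G: "simple_graph G" and iso: "graph_iso (star_graph n) G"
    and P: "small_partition k (vertices G) P"
  shows "n \<le> card (crossing_edges G P) + k"
proof -
  obtain f where bij: "bij_betw f {0..n} (vertices G)"
      and E: "edges G = (\<lambda>e. f ` e) ` {{0, i} |i. 1 \<le> i \<and> i \<le> n}"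
    using iso by (auto simp: graph_iso_def star_graph_def)
  have inj: "inj_on f {0..n}" using bij by (simp add: bij_betw_def)
  have edge: "{f 0, f i} \<in> edges G" if "i \<in> {1..n}" for i
  proof -
    have "f ` {0, i} \<in> edges G" unfolding E by (rule imageI) (use that in auto)
    then show ?thesis by simp
  qed
  have part: "partition_on (vertices G) P" using P by (simp add: small_partition_def)
  have "f 0 \<in> vertices G" using bij by (auto simp: bij_betw_def)
  then obtain A where A: "A \<in> P" "f 0 \<in> A" using part by (auto simp: partition_on_def)
  have "A \<subseteq> vertices G" using part A by (auto simp: partition_on_def)
  then have "finite A" using G by (auto simp: simple_graph_def intro: finite_subset)
  let ?in = "{i \<in> {1..n}. f i \<in> A}" and ?out = "{i \<in> {1..n}. f i \<notin> A}"
  have "card ?in \<le> card A"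
    by (rule card_inj_on_le[of f]) (use inj \<open>finite A\<close> in \<open>auto simp: inj_on_def\<close>)
  also have "\<dots> \<le> k" using P A by (simp add: small_partition_def)
  finally have "card ?in \<le> k" .
  moreover have "card ?out \<le> card (crossing_edges G P)"
  proof (rule card_inj_on_le[of "\<lambda>i. {f 0, f i}"])
    show "inj_on (\<lambda>i. {f 0, f i}) ?out"
      using inj by (auto simp: inj_on_def doubleton_eq_iff)
    have "\<not> {f 0, f i} \<subseteq> B" if "B \<in> P" "f i \<notin> A" for i B
      using partition_part_unique[OF part \<open>B \<in> P\<close> A(1), of "f 0"] that A by auto
    then show "(\<lambda>i. {f 0, f i}) ` ?out \<subseteq> crossing_edges G P"
      using edge by (auto simp: crossing_edges_def)
  qed (use G in \<open>rule finite_crossing_edges\<close>)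
  moreover have "n = card ?in + card ?out"
  proof -
    have "card (?in \<union> ?out) = card ?in + card ?out" by (rule card_Un_disjoint) auto
    moreover have "?in \<union> ?out = {1..n}" by auto
    ultimately show ?thesis by simp
  qed
  ultimately show ?thesis by linarith
qed

text \<open>Otherwise every walk from \<open>v\<close> stays in \<open>A\<close>, which is too small to contain all vertices.\<close>

lemma connected_has_crossing_edge:
  assumes T: "connected_graph T" and large: "finite A" "card A < card (vertices T)"
    and part: "v \<in> vertices T" "v \<in> A"
  obtains x y where "{x, y} \<in> edges T" "x \<in> A" "y \<notin> A"
proof (rule ccontr)
  assume "\<not> thesis"
  then have closed: "\<forall>x y. {x, y} \<in> edges T \<longrightarrow> x \<in> A \<longrightarrow> y \<in> A"
    using that by blast
  have "vertices T \<subseteq> A"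
  proof
    fix w assume "w \<in> vertices T"
    then have "(v, w) \<in> (adjacency T)\<^sup>*" using T part by (auto simp: connected_graph_def)
    then show "w \<in> A"
      by induction (use part closed in \<open>auto simp: adjacency_def\<close>)
  qed
  then show False using large card_mono[of A "vertices T"] by simp
qed

text \<open>
  A part meets a copy of \<open>T\<close> in fewer vertices than \<open>T\<close> has, so an edge of the copy leaves it;
  such edges of different copies are disjoint and hence different.
\<close>

lemma copies_crossing_edges:
  assumes G: "simple_graph G" and iso: "graph_iso (copies m T) G"
    and T: "simple_graph T" "connected_graph T" "k < card (vertices T)"
    and P: "small_partition k (vertices G) P"
  shows "m \<le> card (crossing_edges G P)"
proof -
  obtain f where bij: "bij_betw f ({..<m} \<times> vertices T) (vertices G)"
      and E: "edges G = (\<lambda>e. f ` e) ` {Pair i ` e |i e. i < m \<and> e \<in> edges T}"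
    using iso by (auto simp: graph_iso_def copies_def)
  have inj: "inj_on f ({..<m} \<times> vertices T)" using bij by (simp add: bij_betw_def)
  have part: "partition_on (vertices G) P" using P by (simp add: small_partition_def)
  obtain v where v: "v \<in> vertices T" using T by (auto simp: connected_graph_def)
  have "\<exists>e. e \<in> edges T \<and> f ` Pair i ` e \<in> crossing_edges G P" if "i < m" for i
  proof -
    have "f (i, v) \<in> vertices G" using bij v that by (auto simp: bij_betw_def)
    then obtain A where A: "A \<in> P" "f (i, v) \<in> A" using part by (auto simp: partition_on_def)
    \<comment> \<open>the trace of the part \<open>A\<close> on the \<open>i\<close>-th copy of \<open>T\<close>\<close>
    let ?A = "{x \<in> vertices T. f (i, x) \<in> A}"
    have fT: "finite (vertices T)" using T by (simp add: simple_graph_def)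
    have "A \<subseteq> vertices G" using part A by (auto simp: partition_on_def)
    then have "finite A" using G by (auto simp: simple_graph_def intro: finite_subset)
    have "card ?A \<le> card A"
      by (rule card_inj_on_le[of "\<lambda>x. f (i, x)"])
        (use inj \<open>finite A\<close> that in \<open>auto simp: inj_on_def\<close>)
    also have "\<dots> \<le> k" using P A by (simp add: small_partition_def)
    finally have small: "card ?A < card (vertices T)" using T by simp
    obtain x y where xy: "{x, y} \<in> edges T" "x \<in> ?A" "y \<notin> ?A"
      by (rule connected_has_crossing_edge[OF T(2) _ small v]) (use fT v A in auto)
    have "y \<in> vertices T" using xy T(1) by (auto simp: simple_graph_def)
    then have ends: "f (i, x) \<in> A" "f (i, y) \<notin> A" using xy by auto
    have "f ` Pair i ` {x, y} \<in> edges G" unfolding E by (rule imageI) (use that xy in blast)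
    moreover have "\<not> f ` Pair i ` {x, y} \<subseteq> B" if "B \<in> P" for B
      using partition_part_unique[OF part that A(1), of "f (i, x)"] ends by auto
    ultimately have "f ` Pair i ` {x, y} \<in> crossing_edges G P"
      unfolding crossing_edges_def by blast
    then show ?thesis using xy(1) by blast
  qed
  then obtain e where e: "\<And>i. i < m \<Longrightarrow> e i \<in> edges T"
      "\<And>i. i < m \<Longrightarrow> f ` Pair i ` e i \<in> crossing_edges G P"
    by metis
  have "inj_on (\<lambda>i. f ` Pair i ` e i) {..<m}"
  proof (rule inj_onI)
    fix i j assume ij: "i \<in> {..<m}" "j \<in> {..<m}" and eq: "f ` Pair i ` e i = f ` Pair j ` e j"
    have sub: "e i \<subseteq> vertices T" "e j \<subseteq> vertices T"
      using e(1) ij T(1) by (auto simp: simple_graph_def)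
    have "Pair i ` e i = Pair j ` e j"
      by (rule inj_on_image_eq_iff[OF inj, THEN iffD1, OF _ _ eq]) (use sub ij in auto)
    moreover have "e i \<noteq> {}" using e(1)[of i] ij T(1) by (auto simp: simple_graph_def)
    ultimately show "i = j" by auto
  qed
  then have "card {..<m} \<le> card (crossing_edges G P)"
    by (rule card_inj_on_le) (use e finite_crossing_edges[OF G] in auto)
  then show ?thesis by simp
qed

section \<open>Subgraphs of the graphs in a class\<close>

lemma graph_iso_refl: "graph_iso G G"
  unfolding graph_iso_def by (rule exI[of _ id]) auto

lemma graph_iso_trans:
  assumes "graph_iso G H" "graph_iso H K"
  shows "graph_iso G K"
proof -
  obtain f where f: "bij_betw f (vertices G) (vertices H)" "(\<lambda>e. f ` e) ` edges G = edges H"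
    using assms by (auto simp: graph_iso_def)
  obtain g where g: "bij_betw g (vertices H) (vertices K)" "(\<lambda>e. g ` e) ` edges H = edges K"
    using assms by (auto simp: graph_iso_def)
  have "(\<lambda>e. (g \<circ> f) ` e) ` edges G = edges K"
    unfolding g(2)[symmetric] f(2)[symmetric] by (simp add: image_image image_comp)
  then show ?thesis
    using bij_betw_trans[OF f(1) g(1)] unfolding graph_iso_def by blast
qed

lemma graph_iso_sym:
  assumes "simple_graph G" "graph_iso G H"
  shows "graph_iso H G"
proof -
  obtain f where f: "bij_betw f (vertices G) (vertices H)" "(\<lambda>e. f ` e) ` edges G = edges H"
    using assms by (auto simp: graph_iso_def)
  let ?g = "inv_into (vertices G) f"
  have "?g ` f ` e = e" if "e \<in> edges G" for e
    using f(1) that assms(1)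
    by (intro inv_into_image_cancel) (auto simp: bij_betw_def simple_graph_def)
  then have "(\<lambda>e. ?g ` e) ` edges H = edges G"
    unfolding f(2)[symmetric] by (simp add: image_image)
  then show ?thesis
    using bij_betw_inv_into[OF f(1)] unfolding graph_iso_def by blast
qed

lemma in_class_of_subgraph:
  assumes "subgraph_ideal \<C>" "G \<in> \<C>" "subgraph_of H G" "graph_iso K H"
  shows "in_class K \<C>"
proof -
  have "H \<in> \<C>"
    using assms graph_iso_refl[of H] unfolding subgraph_ideal_def subgraph_of_def by blast
  then show ?thesis using assms(4) unfolding in_class_def by blast
qed

lemma star_in_class_of_degree:
  assumes C: "subgraph_ideal \<C>" "G \<in> \<C>"
    and deg: "n \<ge> 1" "n \<le> card {e \<in> edges G. v \<in> e}"
  shows "in_class (star_graph n) \<C>"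
proof -
  have G: "simple_graph G" using C by (auto simp: subgraph_ideal_def)
  obtain F where F: "F \<subseteq> {e \<in> edges G. v \<in> e}" "card F = n" "finite F"
    using obtain_subset_with_card_n[OF deg(2)] by blast
  obtain h where h: "bij_betw h {1..n} F"
    using ex_bij_betw_nat_finite_1[OF F(3)] F(2) by auto
  have "\<exists>w. h i = {v, w} \<and> w \<noteq> v \<and> w \<in> vertices G \<and> v \<in> vertices G" if "i \<in> {1..n}" for i
  proof -
    have "h i \<in> F" using h that by (auto simp: bij_betw_def)
    then have "h i \<in> edges G" "v \<in> h i" using F(1) by auto
    then show ?thesis by (elim edge_endpoints[OF G]) auto
  qed
  then obtain w where w: "\<And>i. i \<in> {1..n} \<Longrightarrow>
      h i = {v, w i} \<and> w i \<noteq> v \<and> w i \<in> vertices G \<and> v \<in> vertices G"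
    by metis
  define f where "f i = (if i = 0 then v else w i)" for i
  define H where "H = \<lparr>vertices = f ` {0..n}, edges = F\<rparr>"
  have hf: "h i = {f 0, f i}" if "i \<in> {1..n}" for i using w[OF that] that by (simp add: f_def)
  have hF: "h ` {1..n} = F" using h by (simp add: bij_betw_def)
  have "inj_on f {0..n}"
  proof (rule inj_onI)
    fix i j assume ij: "i \<in> {0..n}" "j \<in> {0..n}" and eq: "f i = f j"
    show "i = j"
    proof (cases "i = 0 \<or> j = 0")
      case True
      then show ?thesis using eq w[of i] w[of j] ij by (auto simp: f_def split: if_splits)
    next
      case False
      then have "h i = h j" using hf[of i] hf[of j] ij eq by auto
      moreover have "i \<in> {1..n}" "j \<in> {1..n}" using False ij by auto
      ultimately show ?thesis using inj_onD[OF bij_betw_imp_inj_on[OF h]] by blast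
    qed
  qed
  moreover have "(\<lambda>e. f ` e) ` {{0, i} |i. 1 \<le> i \<and> i \<le> n} = F"
  proof -
    have "{{0, i} |i. 1 \<le> i \<and> i \<le> n} = (\<lambda>i. {0, i}) ` {1..n}" by auto
    then have "(\<lambda>e. f ` e) ` {{0, i} |i. 1 \<le> i \<and> i \<le> n} = (\<lambda>i. {f 0, f i}) ` {1..n}"
      by (simp add: image_image)
    also have "\<dots> = h ` {1..n}" using hf by (intro image_cong) auto
    finally show ?thesis using hF by simp
  qed
  ultimately have iso: "graph_iso (star_graph n) H"
    unfolding graph_iso_def star_graph_def H_def by (auto simp: bij_betw_def)
  have "e \<subseteq> f ` {0..n}" if "e \<in> F" for e
  proof -
    obtain i where "i \<in> {1..n}" "e = h i" using \<open>e \<in> F\<close> hF by auto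
    then show ?thesis using hf[of i] by auto
  qed
  moreover have "f ` {0..n} \<subseteq> vertices G"
    using w[of 1] w deg(1) by (auto simp: f_def)
  moreover have "F \<subseteq> edges G" using F by auto
  ultimately have "subgraph_of H G"
    using G unfolding subgraph_of_def simple_graph_def H_def by auto
  then show ?thesis by (rule in_class_of_subgraph[OF C _ iso])
qed

lemma copies_in_class_of_disjoint_subgraphs:
  assumes C: "subgraph_ideal \<C>" "G \<in> \<C>"
    and S: "finite \<S>" "disjoint_family_on vertices \<S>"
      "\<And>H. H \<in> \<S> \<Longrightarrow> subgraph_of H G \<and> graph_iso T H"
  shows "in_class (copies (card \<S>) T) \<C>"
proof -
  let ?m = "card \<S>"
  have G: "simple_graph G" using C by (auto simp: subgraph_ideal_def)
  obtain s where s: "bij_betw s {..<?m} \<S>"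
    using ex_bij_betw_nat_finite[OF S(1)] by (auto simp: atLeast0LessThan)
  then have sS: "s ` {..<?m} = \<S>" by (simp add: bij_betw_def)
  have UN_s: "(\<Union>i<?m. h (s i)) = \<Union>(h ` \<S>)" for h :: "'a ugraph \<Rightarrow> 'c set"
    by (metis sS image_image)
  have "\<exists>f. bij_betw f (vertices T) (vertices (s i)) \<and> (\<lambda>e. f ` e) ` edges T = edges (s i)"
    if "i < ?m" for i
  proof -
    have "s i \<in> \<S>" using sS that by blast
    then show ?thesis using S(3) unfolding graph_iso_def by blast
  qed
  then obtain f where f: "\<And>i. i < ?m \<Longrightarrow> bij_betw (f i) (vertices T) (vertices (s i))"
      "\<And>i. i < ?m \<Longrightarrow> (\<lambda>e. f i ` e) ` edges T = edges (s i)"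
    by metis
  define g where "g = (\<lambda>(i, x). f i x)"
  define H where "H = \<lparr>vertices = \<Union>(vertices ` \<S>), edges = \<Union>(edges ` \<S>)\<rparr>"
  have "g ` ({..<?m} \<times> vertices T) = (\<Union>i<?m. f i ` vertices T)" by (auto simp: g_def)
  also have "\<dots> = (\<Union>i<?m. vertices (s i))" using f(1) by (auto simp: bij_betw_def)
  also have "\<dots> = vertices H" by (simp add: H_def UN_s)
  finally have im: "g ` ({..<?m} \<times> vertices T) = vertices H" .
  have "inj_on g ({..<?m} \<times> vertices T)"
  proof (rule inj_onI, clarify)
    fix i x j y assume ij: "i < ?m" "j < ?m" and xy: "x \<in> vertices T" "y \<in> vertices T"
      and eq: "g (i, x) = g (j, y)"
    have "f i x \<in> vertices (s i)" "f j y \<in> vertices (s j)"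
      using bij_betwE[OF f(1)] ij xy by blast+
    moreover have eq': "f i x = f j y" using eq by (simp add: g_def)
    ultimately have "vertices (s i) \<inter> vertices (s j) \<noteq> {}" by auto
    moreover have "s i \<in> \<S>" "s j \<in> \<S>" using s ij by (auto simp: bij_betw_def)
    ultimately have "s i = s j" using disjoint_family_onD[OF S(2)] by blast
    then have "i = j"
      using inj_onD[OF bij_betw_imp_inj_on[OF s]] ij by blast
    moreover have "x = y"
      using inj_onD[OF bij_betw_imp_inj_on[OF f(1)[OF ij(1)]]] eq' xy unfolding \<open>i = j\<close> by blast
    ultimately show "i = j \<and> x = y" by blast
  qed
  moreover have "(\<lambda>e. g ` e) ` {Pair i ` e |i e. i < ?m \<and> e \<in> edges T} = edges H"
  proof -
    have "(\<lambda>e. g ` e) ` {Pair i ` e |i e. i < ?m \<and> e \<in> edges T}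
        = (\<Union>i<?m. (\<lambda>e. g ` Pair i ` e) ` edges T)"
      by blast
    also have "\<dots> = (\<Union>i<?m. edges (s i))"
      using f(2) by (simp add: image_image g_def)
    also have "\<dots> = edges H" by (simp add: H_def UN_s)
    finally show ?thesis .
  qed
  ultimately have iso: "graph_iso (copies ?m T) H"
    using im unfolding graph_iso_def copies_def by (auto simp: bij_betw_def)
  have sub: "vertices H \<subseteq> vertices G" "edges H \<subseteq> edges G"
    using S(3) by (auto simp: subgraph_of_def H_def)
  moreover have "e \<subseteq> vertices H" if "e \<in> edges H" for e
  proof -
    obtain K where K: "K \<in> \<S>" "e \<in> edges K" using \<open>e \<in> edges H\<close> by (auto simp: H_def)
    then have "simple_graph K" using S(3) by (simp add: subgraph_of_def)
    then have "e \<subseteq> vertices K" using K by (auto simp: simple_graph_def)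
    then show ?thesis using K by (auto simp: H_def)
  qed
  ultimately have "subgraph_of H G"
    using G finite_subset[OF sub(1)] by (auto simp: subgraph_of_def simple_graph_def)
  then show ?thesis by (rule in_class_of_subgraph[OF C _ iso])
qed

section \<open>Packings of small trees\<close>

lemma sym_adjacency: "sym (adjacency G)"
  by (auto simp: sym_def adjacency_def insert_commute)

lemma connected_graphI:
  assumes "v \<in> vertices G" "\<And>x. x \<in> vertices G \<Longrightarrow> (v, x) \<in> (adjacency G)\<^sup>*"
  shows "connected_graph G"
  unfolding connected_graph_def
proof (intro conjI ballI)
  show "vertices G \<noteq> {}" using assms(1) by blast
  fix x y assume "x \<in> vertices G" "y \<in> vertices G"
  then have "(x, v) \<in> (adjacency G)\<^sup>*" "(v, y) \<in> (adjacency G)\<^sup>*"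
    using symD[OF sym_rtrancl[OF sym_adjacency] assms(2)] assms(2) by auto
  then show "(x, y) \<in> (adjacency G)\<^sup>*" by (rule rtrancl_trans)
qed

text \<open>
  A minimal edge set that keeps the graph connected is acyclic: the ends of an edge of a cycle stay
  joined by the rest of the cycle.
\<close>

lemma spanning_tree_exists:
  assumes G: "simple_graph G" "connected_graph G"
  obtains H where "subgraph_of H G" "vertices H = vertices G" "is_tree H"
proof -
  let ?g = "\<lambda>F. \<lparr>vertices = vertices G, edges = F\<rparr>"
  let ?\<F> = "{F \<in> Pow (edges G). connected_graph (?g F)}"
  have "finite ?\<F>" using finite_edges[OF G(1)] by simp
  moreover have "edges G \<in> ?\<F>"
    using G(2) by (simp add: connected_graph_def adjacency_def)
  ultimately obtain F where F: "F \<in> ?\<F>" and minimal: "\<And>F'. F' \<in> ?\<F> \<Longrightarrow> F' \<subseteq> F \<Longrightarrow> F' = F"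
    using finite_has_minimal[of ?\<F>] by (metis (no_types, lifting) empty_iff)
  have acyclic: "\<not> is_cycle (?g F) c" for c
  proof
    assume c: "is_cycle (?g F) c"
    let ?n = "length c"
    let ?e = "{c ! (?n - 1), c ! 0}"
    let ?R = "adjacency (?g (F - {?e}))"
    have n: "3 \<le> ?n" "distinct c" using c by (auto simp: is_cycle_def)
    have edge: "{c ! i, c ! (Suc i mod ?n)} \<in> F" if "i < ?n" for i
      using c that by (simp add: is_cycle_def)
    have along: "i < ?n \<Longrightarrow> (c ! 0, c ! i) \<in> ?R\<^sup>*" for i
    proof (induction i)
      case (Suc i)
      have "{c ! i, c ! Suc i} \<in> F" using edge[of i] Suc.prems by simp
      moreover have "{c ! i, c ! Suc i} \<noteq> ?e"
      proof -
        have len: "0 < ?n" "?n - 1 < ?n" "i < ?n" using Suc.prems by auto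
        have index: "c ! Suc i \<noteq> c ! 0" "c ! i = c ! 0 \<longleftrightarrow> i = 0"
            "c ! Suc i = c ! (?n - 1) \<longleftrightarrow> Suc i = ?n - 1"
          using nth_eq_iff_index_eq[OF n(2) Suc.prems len(1)]
            nth_eq_iff_index_eq[OF n(2) len(3,1)] nth_eq_iff_index_eq[OF n(2) Suc.prems len(2)]
          by simp_all
        show ?thesis
        proof
          assume "{c ! i, c ! Suc i} = ?e"
          then have "i = 0 \<and> Suc i = ?n - 1" using index unfolding doubleton_eq_iff by metis
          then show False using n(1) by linarith
        qed
      qed
      ultimately have "(c ! i, c ! Suc i) \<in> ?R" by (simp add: adjacency_def)
      then show ?case using Suc by (meson Suc_lessD rtrancl.rtrancl_into_rtrancl)
    qed simp
    have "?n - 1 < ?n" using n(1) by linarith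
    then have end_end: "(c ! 0, c ! (?n - 1)) \<in> ?R\<^sup>*" by (rule along)
    note ends = end_end symD[OF sym_rtrancl[OF sym_adjacency] end_end]
    have "adjacency (?g F) \<subseteq> ?R\<^sup>*"
    proof clarify
      fix x y assume xy: "(x, y) \<in> adjacency (?g F)"
      show "(x, y) \<in> ?R\<^sup>*"
      proof (cases "{x, y} = ?e")
        case True
        then show ?thesis using ends unfolding doubleton_eq_iff by blast
      next
        case False
        then show ?thesis using xy by (auto simp: adjacency_def)
      qed
    qed
    then have "(adjacency (?g F))\<^sup>* \<subseteq> ?R\<^sup>*" by (rule rtrancl_subset_rtrancl)
    then have "F - {?e} \<in> ?\<F>" using F by (auto simp: connected_graph_def)
    then have "F - {?e} = F" by (rule minimal) auto
    moreover have "?e \<in> F"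
    proof -
      have "Suc (?n - 1) = ?n" using n(1) by linarith
      then have "Suc (?n - 1) mod ?n = 0" by (simp only: mod_self)
      then show ?thesis using edge[OF \<open>?n - 1 < ?n\<close>] by simp
    qed
    ultimately show False by blast
  qed
  show ?thesis
  proof (rule that[of "?g F"])
    show "subgraph_of (?g F) G" using F G(1) by (auto simp: subgraph_of_def simple_graph_def)
    then show "is_tree (?g F)" using F acyclic by (simp add: is_tree_def subgraph_of_def)
  qed simp
qed

text \<open>
  A connected graph inside the component grows by one vertex at a time: as long as it misses part
  of the component, some edge of the component leaves it.
\<close>

lemma component_contains_connected_subgraph:
  fixes G :: "'a ugraph"
  defines "R Y \<equiv> {(u, w). u \<in> Y \<and> w \<in> Y \<and> {u, w} \<in> edges G}"
  assumes G: "simple_graph G" and Y: "Y \<subseteq> vertices G" "v \<in> Y"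
    and n: "1 \<le> n" "n \<le> card ((R Y)\<^sup>* `` {v})"
  shows "\<exists>H. subgraph_of H G \<and> connected_graph H \<and> vertices H \<subseteq> Y \<and> card (vertices H) = n"
proof -
  let ?R = "R Y"
  have "\<exists>H. subgraph_of H G \<and> vertices H \<subseteq> Y \<and> card (vertices H) = n \<and> v \<in> vertices H
      \<and> (\<forall>x\<in>vertices H. (v, x) \<in> (adjacency H)\<^sup>*)"
    using n
  proof (induction n rule: nat_induct_at_least)
    case base
    have "subgraph_of \<lparr>vertices = {v}, edges = {}\<rparr> G"
      using Y by (auto simp: subgraph_of_def simple_graph_def)
    then show ?case using Y by (intro exI[of _ "\<lparr>vertices = {v}, edges = {}\<rparr>"]) auto
  next
    case (Suc n)
    then obtain H where H: "subgraph_of H G" "vertices H \<subseteq> Y" "card (vertices H) = n"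
        "v \<in> vertices H" "\<And>x. x \<in> vertices H \<Longrightarrow> (v, x) \<in> (adjacency H)\<^sup>*"
      by (metis Suc_leD)
    have fin: "finite (vertices H)" using H by (auto simp: subgraph_of_def simple_graph_def)
    have "\<not> ?R\<^sup>* `` {v} \<subseteq> vertices H"
      using card_mono[OF fin, of "?R\<^sup>* `` {v}"] Suc.prems H(3) by auto
    have "\<exists>u w. u \<in> vertices H \<and> w \<notin> vertices H \<and> (u, w) \<in> ?R"
    proof (rule ccontr)
      assume no_exit: "\<not> ?thesis"
      have "x \<in> vertices H" if "(v, x) \<in> ?R\<^sup>*" for x
        using that
      proof induction
        case base
        then show ?case by (rule H(4))
      next
        case (step y z)
        then show ?case using no_exit by blast
      qed
      with \<open>\<not> ?R\<^sup>* `` {v} \<subseteq> vertices H\<close> show False by auto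
    qed
    then obtain u w where uw: "u \<in> vertices H" "w \<notin> vertices H" "w \<in> Y" "{u, w} \<in> edges G"
      by (auto simp: R_def)
    define K where "K = \<lparr>vertices = insert w (vertices H), edges = insert {u, w} (edges H)\<rparr>"
    have "subgraph_of K G"
      using H(1) uw Y(1) by (auto simp: subgraph_of_def simple_graph_def K_def card_2_iff)
    moreover have "(v, x) \<in> (adjacency K)\<^sup>*" if "x \<in> vertices K" for x
    proof -
      have "adjacency H \<subseteq> adjacency K" by (auto simp: adjacency_def K_def)
      then have old: "(v, y) \<in> (adjacency K)\<^sup>*" if "y \<in> vertices H" for y
        using H(5)[OF that] rtrancl_mono by blast
      have "(u, w) \<in> adjacency K" by (auto simp: adjacency_def K_def)
      then have "(v, w) \<in> (adjacency K)\<^sup>*"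
        using old[OF uw(1)] by (rule rtrancl.rtrancl_into_rtrancl[rotated])
      then show ?thesis using old that by (auto simp: K_def)
    qed
    moreover have "vertices K \<subseteq> Y" "card (vertices K) = Suc n" "v \<in> vertices K"
      using uw H fin by (auto simp: K_def)
    ultimately show ?case by blast
  qed
  then show ?thesis using connected_graphI by metis
qed

definition tree_packing :: "nat \<Rightarrow> 'a ugraph \<Rightarrow> 'a ugraph set \<Rightarrow> bool" where
  "tree_packing n G \<S> \<longleftrightarrow> finite \<S> \<and> disjoint_family_on vertices \<S> \<and>
     (\<forall>H\<in>\<S>. subgraph_of H G \<and> is_tree H \<and> card (vertices H) = n)"

text \<open>
  Every graph on \<open>n\<close> vertices has a copy on one fixed set of \<open>n\<close> vertices, which carries only
  finitely many edge sets. Choosing a graph from \<open>\<X>\<close> for each edge set that occurs gives the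
  representatives.
\<close>

lemma finite_iso_representatives:
  fixes \<X> :: "'a::infinite ugraph set"
  assumes X: "\<And>H. H \<in> \<X> \<Longrightarrow> simple_graph H \<and> card (vertices H) = n"
  obtains \<R> where "finite \<R>" "\<R> \<subseteq> \<X>" "\<And>H. H \<in> \<X> \<Longrightarrow> \<exists>T\<in>\<R>. graph_iso T H"
proof -
  obtain V :: "'a set" where V: "finite V" "card V = n"
    using infinite_arbitrarily_large[OF infinite_UNIV] by metis
  have "\<exists>F. F \<subseteq> Pow V \<and> graph_iso H \<lparr>vertices = V, edges = F\<rparr>" if "H \<in> \<X>" for H
  proof -
    have H: "simple_graph H" "card (vertices H) = n" using X[OF that] by auto
    then obtain f where f: "bij_betw f (vertices H) V"
      using finite_same_card_bij[of "vertices H" V] V by (auto simp: simple_graph_def)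
    then have "(\<lambda>e. f ` e) ` edges H \<subseteq> Pow V"
      using H(1) by (auto simp: bij_betw_def simple_graph_def)
    then show ?thesis using f by (auto simp: graph_iso_def)
  qed
  then obtain code where code: "\<And>H. H \<in> \<X> \<Longrightarrow> code H \<subseteq> Pow V"
      "\<And>H. H \<in> \<X> \<Longrightarrow> graph_iso H \<lparr>vertices = V, edges = code H\<rparr>"
    by metis
  let ?rep = "inv_into \<X> code"
  show ?thesis
  proof (rule that[of "?rep ` code ` \<X>"])
    have "code ` \<X> \<subseteq> Pow (Pow V)" using code(1) by auto
    then have "finite (code ` \<X>)" by (rule finite_subset) (use V in simp)
    then show "finite (?rep ` code ` \<X>)" by simp
    show "?rep ` code ` \<X> \<subseteq> \<X>" by (auto intro: inv_into_into)
    fix H assume "H \<in> \<X>"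
    let ?T = "?rep (code H)"
    have T: "?T \<in> \<X>" "code ?T = code H"
      using \<open>H \<in> \<X>\<close> by (simp_all add: inv_into_into f_inv_into_f)
    have "graph_iso ?T H"
      using graph_iso_trans[OF code(2)[OF T(1)]] T(2) graph_iso_sym code(2) X \<open>H \<in> \<X>\<close> by metis
    then show "\<exists>T\<in>?rep ` code ` \<X>. graph_iso T H" using \<open>H \<in> \<X>\<close> by blast
  qed
qed

text \<open>
  A packing contains each of the finitely many types \<open>T\<close> of trees at most \<open>m T\<close> times, where
  \<open>m T\<close> is a number of disjoint copies of \<open>T\<close> that the class omits.
\<close>

lemma tree_packing_bounded:
  fixes \<C> :: "'a::infinite ugraph set"
  assumes C: "subgraph_ideal \<C>"
    and omit: "\<And>T :: 'a ugraph. is_tree T \<Longrightarrow> card (vertices T) = n \<Longrightarrow>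
      \<exists>m. \<not> in_class (copies m T) \<C>"
  obtains M where "\<And>G \<S>. G \<in> \<C> \<Longrightarrow> tree_packing n G \<S> \<Longrightarrow> card \<S> \<le> M"
proof -
  let ?\<X> = "{T :: 'a ugraph. is_tree T \<and> card (vertices T) = n}"
  obtain \<R> where R: "finite \<R>" "\<R> \<subseteq> ?\<X>" "\<And>H. H \<in> ?\<X> \<Longrightarrow> \<exists>T\<in>\<R>. graph_iso T H"
    by (rule finite_iso_representatives[of ?\<X> n]) (auto simp: is_tree_def)
  obtain m where m: "\<And>T. T \<in> ?\<X> \<Longrightarrow> \<not> in_class (copies (m T) T) \<C>"
    using omit by (metis (mono_tags, lifting) mem_Collect_eq)
  show ?thesis
  proof (rule that[of "\<Sum>T\<in>\<R>. m T"])
    fix G \<S> assume G: "G \<in> \<C>" and pack: "tree_packing n G \<S>"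
    let ?of = "\<lambda>T. {H \<in> \<S>. graph_iso T H}"
    have "card (?of T) \<le> m T" if "T \<in> \<R>" for T
    proof (rule ccontr)
      assume "\<not> card (?of T) \<le> m T"
      then obtain \<S>' where S': "\<S>' \<subseteq> ?of T" "card \<S>' = m T" "finite \<S>'"
        using obtain_subset_with_card_n[of "m T" "?of T"] by (metis nat_le_linear)
      have "disjoint_family_on vertices \<S>'"
        using pack S'(1) unfolding tree_packing_def disjoint_family_on_def by blast
      then have "in_class (copies (card \<S>') T) \<C>"
        by (rule copies_in_class_of_disjoint_subgraphs[OF C G S'(3)])
          (use pack S'(1) in \<open>auto simp: tree_packing_def\<close>)
      then show False using m[of T] S'(2) R(2) that by auto
    qed
    moreover have "\<S> = (\<Union>T\<in>\<R>. ?of T)"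
      using R(3) pack by (auto simp: tree_packing_def)
    ultimately show "card \<S> \<le> (\<Sum>T\<in>\<R>. m T)"
      using card_UN_le[OF R(1), of ?of] sum_mono[of \<R> "\<lambda>T. card (?of T)" m] by simp
  qed
qed

text \<open>
  The partition consists of the components of \<open>G - X\<close> and the singletons of \<open>X\<close>, which are the
  classes of reachability by edges that avoid \<open>X\<close>.
\<close>

lemma small_partition_of_hitting_set:
  assumes G: "simple_graph G" and "k > 0" and X: "X \<subseteq> vertices G"
    and hit: "\<And>H. subgraph_of H G \<Longrightarrow> is_tree H \<Longrightarrow> card (vertices H) = k + 1 \<Longrightarrow>
      vertices H \<inter> X \<noteq> {}"
    and deg: "\<And>v. card {e \<in> edges G. v \<in> e} \<le> d"
  shows "\<exists>P. small_partition k (vertices G) P \<and> card (crossing_edges G P) \<le> card X * d"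
proof -
  let ?V = "vertices G" and ?Y = "vertices G - X"
  let ?R = "{(u, w). u \<in> ?Y \<and> w \<in> ?Y \<and> {u, w} \<in> edges G}"
  let ?r = "?R\<^sup>* \<inter> ?V \<times> ?V"
  have fV: "finite ?V" using G by (simp add: simple_graph_def)
  have stay: "w \<in> ?V" if "(v, w) \<in> ?R\<^sup>*" "v \<in> ?V" for v w
    using that by induction auto
  have symR: "sym ?R" by (auto simp: sym_def insert_commute)
  have "equiv ?V ?r"
  proof (rule equivI)
    show "refl_on ?V ?r" by (auto simp: refl_on_def)
    show "sym ?r" using sym_rtrancl[OF symR] by (auto simp: sym_def)
    show "trans ?r" by (auto simp: trans_def)
  qed auto
  then have part: "partition_on ?V (?V // ?r)" by (rule partition_on_quotient)
  have small: "card (?r `` {v}) \<le> k" if "v \<in> ?V" for v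
  proof (cases "v \<in> X")
    case True
    have "w = v" if "(v, w) \<in> ?R\<^sup>*" for w
      using that by (cases rule: converse_rtranclE) (use True in auto)
    then have "?r `` {v} \<subseteq> {v}" by auto
    then have "card (?r `` {v}) \<le> 1" using card_mono[of "{v}"] by fastforce
    then show ?thesis using \<open>k > 0\<close> by linarith
  next
    case False
    show ?thesis
    proof (rule ccontr)
      assume "\<not> ?thesis"
      moreover have "?r `` {v} = ?R\<^sup>* `` {v}" using stay[OF _ that] that by blast
      ultimately have "k + 1 \<le> card (?R\<^sup>* `` {v})" by simp
      then obtain K where K: "subgraph_of K G" "connected_graph K" "vertices K \<subseteq> ?Y"
          "card (vertices K) = k + 1"
        using component_contains_connected_subgraph[OF G, of ?Y v "k + 1"] \<open>v \<in> ?V\<close> False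
        by auto
      have "simple_graph K" using K by (simp add: subgraph_of_def)
      then obtain H where H: "subgraph_of H K" "vertices H = vertices K" "is_tree H"
        using spanning_tree_exists K(2) by metis
      have "subgraph_of H G" using H(1) K(1) by (auto simp: subgraph_of_def)
      then show False using hit[of H] H K by auto
    qed
  qed
  have "small_partition k ?V (?V // ?r)"
    unfolding small_partition_def using part small by (auto elim!: quotientE)
  moreover have "card (crossing_edges G (?V // ?r)) \<le> card X * d"
  proof -
    have "crossing_edges G (?V // ?r) \<subseteq> (\<Union>x\<in>X. {e \<in> edges G. x \<in> e})"
    proof
      fix e assume e: "e \<in> crossing_edges G (?V // ?r)"
      then have eE: "e \<in> edges G" by (simp add: crossing_edges_def)
      then obtain u w where uw: "e = {u, w}" "u \<in> ?V" "w \<in> ?V"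
        using edge_endpoints[OF G] by metis
      have "\<not> e \<subseteq> ?r `` {u}"
        using e quotientI[OF uw(2), of ?r] by (simp add: crossing_edges_def)
      then have "(u, w) \<notin> ?R" using uw by auto
      then have "u \<in> X \<or> w \<in> X" using uw eE by auto
      then show "e \<in> (\<Union>x\<in>X. {e \<in> edges G. x \<in> e})" using uw eE by auto
    qed
    moreover have fX: "finite X" using X fV by (rule finite_subset)
    ultimately have "card (crossing_edges G (?V // ?r)) \<le> card (\<Union>x\<in>X. {e \<in> edges G. x \<in> e})"
      using finite_edges[OF G] by (intro card_mono) auto
    also have "\<dots> \<le> (\<Sum>x\<in>X. card {e \<in> edges G. x \<in> e})" by (rule card_UN_le[OF fX])
    also have "\<dots> \<le> card X * d" using sum_bounded_above[of X _ d] deg by simp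
    finally show ?thesis .
  qed
  ultimately show ?thesis by blast
qed

section \<open>The characterisation\<close>

theorem theorem1p2:
  fixes k :: nat and \<C> :: "'a::infinite ugraph set"
  assumes "k > 0"
    and "subgraph_ideal \<C>"
  shows "edge_scattered k \<C> \<longleftrightarrow>
    \<not> (\<forall>n\<ge>1. in_class (star_graph n) \<C>) \<and>
    (\<forall>T :: 'a ugraph. is_tree T \<and> card (vertices T) = k + 1 \<longrightarrow>
       \<not> (\<forall>m\<ge>1. in_class (copies m T) \<C>))"
proof
  have simple: "simple_graph G" if "G \<in> \<C>" for G
    using assms(2) that by (simp add: subgraph_ideal_def)
  note scattered = edge_scattered_iff_crossing[OF assms(1) simple, of \<C>]
  {
    assume "edge_scattered k \<C>"
    then obtain b where b: "\<And>G. G \<in> \<C> \<Longrightarrow>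
        \<exists>P. small_partition k (vertices G) P \<and> card (crossing_edges G P) \<le> b"
      using scattered by auto
    have "\<not> in_class (star_graph (b + k + 1)) \<C>"
    proof
      assume "in_class (star_graph (b + k + 1)) \<C>"
      then obtain G where G: "G \<in> \<C>" "graph_iso (star_graph (b + k + 1)) G"
        by (auto simp: in_class_def)
      then show False
        using b[OF G(1)] star_crossing_edges[OF simple[OF G(1)] G(2)] by fastforce
    qed
    then have "\<not> (\<forall>n\<ge>1. in_class (star_graph n) \<C>)" by (metis le_add2)
    moreover have "\<not> (\<forall>m\<ge>1. in_class (copies m T) \<C>)"
      if T: "is_tree T" "card (vertices T) = k + 1" for T :: "'a ugraph"
    proof
      assume "\<forall>m\<ge>1. in_class (copies m T) \<C>"
      then have "in_class (copies (b + 1) T) \<C>" by simp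
      then obtain G where G: "G \<in> \<C>" "graph_iso (copies (b + 1) T) G"
        by (auto simp: in_class_def)
      obtain P where "small_partition k (vertices G) P" "card (crossing_edges G P) \<le> b"
        using b[OF G(1)] by blast
      then show False
        using copies_crossing_edges[OF simple[OF G(1)] G(2), of k P] T by (auto simp: is_tree_def)
    qed
    ultimately show "\<not> (\<forall>n\<ge>1. in_class (star_graph n) \<C>) \<and>
      (\<forall>T :: 'a ugraph. is_tree T \<and> card (vertices T) = k + 1 \<longrightarrow>
         \<not> (\<forall>m\<ge>1. in_class (copies m T) \<C>))"
      by blast
  next
    assume omit: "\<not> (\<forall>n\<ge>1. in_class (star_graph n) \<C>) \<and>
      (\<forall>T :: 'a ugraph. is_tree T \<and> card (vertices T) = k + 1 \<longrightarrow>
         \<not> (\<forall>m\<ge>1. in_class (copies m T) \<C>))"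
    then obtain d where d: "d \<ge> 1" "\<not> in_class (star_graph d) \<C>" by auto
    have deg: "card {e \<in> edges G. v \<in> e} \<le> d" if "G \<in> \<C>" for G v
      using star_in_class_of_degree[OF assms(2) that d(1), of v] d(2) by linarith
    obtain M where M: "\<And>G \<S>. G \<in> \<C> \<Longrightarrow> tree_packing (k + 1) G \<S> \<Longrightarrow> card \<S> \<le> M"
      using tree_packing_bounded[OF assms(2), of "k + 1"] omit by metis
    have "\<exists>P. small_partition k (vertices G) P \<and> card (crossing_edges G P) \<le> M * (k + 1) * d"
      if "G \<in> \<C>" for G
    proof -
      have "tree_packing (k + 1) G {}" by (simp add: tree_packing_def disjoint_family_on_def)
      then obtain \<S> where S: "tree_packing (k + 1) G \<S>"
          and largest: "\<And>\<S>'. tree_packing (k + 1) G \<S>' \<Longrightarrow> card \<S>' \<le> card \<S>"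
        using ex_has_greatest_nat[of "tree_packing (k + 1) G" "{}" card "Suc M"] M[OF \<open>G \<in> \<C>\<close>]
        by (metis less_Suc_eq_le)
      let ?X = "\<Union>(vertices ` \<S>)"
      have "?X \<subseteq> vertices G" using S by (auto simp: tree_packing_def subgraph_of_def)
      moreover have "vertices H \<inter> ?X \<noteq> {}"
        if H: "subgraph_of H G" "is_tree H" "card (vertices H) = k + 1" for H
      proof
        assume disj: "vertices H \<inter> ?X = {}"
        have "vertices H \<noteq> {}" using H(3) by auto
        then have "H \<notin> \<S>" using disj by blast
        moreover have "tree_packing (k + 1) G (insert H \<S>)"
          using S H disj unfolding tree_packing_def disjoint_family_on_def by blast
        ultimately show False
          using largest[of "insert H \<S>"] S by (simp add: tree_packing_def)
      qed
      \<comment> \<open>as no tree can be added to the packing, \<open>?X\<close> meets every tree on \<open>k + 1\<close> vertices\<close>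
      ultimately obtain P where P: "small_partition k (vertices G) P"
          "card (crossing_edges G P) \<le> card ?X * d"
        using small_partition_of_hitting_set[OF simple assms(1) _ _ deg, OF \<open>G \<in> \<C>\<close> _ _ \<open>G \<in> \<C>\<close>]
        by blast
      have "card ?X \<le> (\<Sum>H\<in>\<S>. card (vertices H))"
        using S by (intro card_UN_le) (simp add: tree_packing_def)
      also have "\<dots> = card \<S> * (k + 1)" using S by (simp add: tree_packing_def)
      also have "\<dots> \<le> M * (k + 1)" using M[OF that S] by (rule mult_le_mono1)
      finally have "card ?X * d \<le> M * (k + 1) * d" by (rule mult_le_mono1)
      then show ?thesis using P by (meson le_trans)
    qed
    then show "edge_scattered k \<C>" using scattered by blast
  }
qed

end
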